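(* Let $X$ be a compact topological space and $f_{1,\infty}=\{f_i\}_{i=1}^\infty$ a sequence of continuous self-maps of $X$. Assume $f_{1,\infty}$ is periodic with period $m\in\mathbb N$, i.e. $f_{im+j}=f_j$ for all $i\ge0$ and $1\le j\le m$. Then for any $Z\subseteq X$ and $\theta\in[0,1]$, \[ \underline{h}_{\mathrm{top}}(f_{1,\infty}^m,Z,\theta)=m\,\underline{h}_{\mathrm{top}}(f_{1,\infty},Z,\theta),\qquad \overline{h}_{\mathrm{top}}(f_{1,\infty}^m,Z,\theta)=m\,\overline{h}_{\mathrm{top}}(f_{1,\infty},Z,\theta), \] where $f_{1,\infty}^m=\{f_{im+1}^m\}_{i=0}^\infty$, with $f_{im+1}^m=f_{im+m}\circ\cdots\circ f_{im+2}\circ f_{im+1}$.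
   Context: Intermediate topological entropies. Let $X$ be a compact topological space and $f_{1,\infty}=\{f_i\}_{i=1}^\infty$ a sequence of continuous maps $X\to X$. Put $f_i^0=\mathrm{id}_X$ and $f_i^j=f_{i+j-1}\circ\cdots\circ f_{i+1}\circ f_i$ for $j\ge1$. For a finite open cover $\mathcal U$ of $X$ and $m\in\mathbb N=\{1,2,\dots\}$, a string of length $m(\mathbf U)=m$ is an element $\mathbf U=(U_0,\dots,U_{m-1})\in\mathcal S_m(\mathcal U):=\mathcal U^m$, and $X(\mathbf U)=\{x\in X: f_1^j(x)\in U_j,\ 0\le j\le m-1\}$. For $Z\subseteq X$, $\alpha\ge0$, $\theta\in[0,1]$, $N\in\mathbb N$ let \[ M(Z,\alpha,\mathcal U,N,\theta)=\inf_{\mathcal G}\sum_{\mathbf U\in\mathcal G}e^{-\alpha m(\mathbf U)}, \] the infimum over all finite or countable collections $\mathcal G\subseteq\bigcup_{N\le m<N/\theta+1}\mathcal S_m(\mathcal U)$ with $Z\subseteq\bigcup_{\mathbf U\in\mathcal G}X(\mathbf U)$ (for $\theta=0$, $N/\theta=+\infty$). Let $\underline m(Z,\alpha,\mathcal U,\theta)=\liminf_{N\to\infty}M(Z,\alpha,\mathcal U,N,\theta)$ and $\overline m(Z,\alpha,\mathcal U,\theta)=\limsup_{N\to\infty}M(Z,\alpha,\mathcal U,N,\theta)$. Set $\underline h_{\mathrm{top}}(f_{1,\infty},Z,\mathcal U,\theta)=\inf\{\alpha\ge0:\underline m(Z,\alpha,\mathcal U,\theta)=0\}$, $\overline h_{\mathrm{top}}(f_{1,\infty},Z,\mathcal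 U,\theta)=\inf\{\alpha\ge0:\overline m(Z,\alpha,\mathcal U,\theta)=0\}$. The lower and upper $\theta$-intermediate topological entropies $\underline h_{\mathrm{top}}(f_{1,\infty},Z,\theta)$ and $\overline h_{\mathrm{top}}(f_{1,\infty},Z,\theta)$, with values in $[0,\infty]$, are the suprema of these quantities over all finite open covers $\mathcal U$ of $X$. The entropies of $f_{1,\infty}^m$ are those of the sequence of maps $f_1^m, f_{m+1}^m, f_{2m+1}^m,\dots$, defined in the same way. *)

theory Defs
  imports "HOL-Analysis.Analysis"
begin

text \<open>
  A sequence of maps \<open>f\<^sub>1, f\<^sub>2, \<dots>\<close> is a function on \<open>nat\<close> whose value at \<open>0\<close> is never used.
  The space is the carrier of an abstract topology, so maps matter only on \<open>topspace X\<close>.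
\<close>

text \<open>\<open>seq_comp f i j\<close> is \<open>f\<^sub>i\<^sup>j = f\<^bsub>i+j-1\<^esub> \<circ> \<dots> \<circ> f\<^bsub>i+1\<^esub> \<circ> f\<^sub>i\<close>.\<close>

primrec seq_comp :: "(nat \<Rightarrow> 'a \<Rightarrow> 'a) \<Rightarrow> nat \<Rightarrow> nat \<Rightarrow> 'a \<Rightarrow> 'a" where
  "seq_comp f i 0 = id"
| "seq_comp f i (Suc j) = f (i + j) \<circ> seq_comp f i j"

text \<open>The sequence \<open>f\<^sub>1\<^sup>m, f\<^bsub>m+1\<^esub>\<^sup>m, f\<^bsub>2m+1\<^esub>\<^sup>m, \<dots>\<close>, again indexed from \<open>1\<close>.\<close>

definition seq_power :: "(nat \<Rightarrow> 'a \<Rightarrow> 'a) \<Rightarrow> nat \<Rightarrow> nat \<Rightarrow> 'a \<Rightarrow> 'a" where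
  "seq_power f m k = seq_comp f ((k - 1) * m + 1) m"

definition periodic_seq_on :: "'a topology \<Rightarrow> (nat \<Rightarrow> 'a \<Rightarrow> 'a) \<Rightarrow> nat \<Rightarrow> bool" where
  "periodic_seq_on X f m \<longleftrightarrow>
     (\<forall>i. \<forall>j\<in>{1..m}. \<forall>x\<in>topspace X. f (i * m + j) x = f j x)"

definition finite_open_cover :: "'a topology \<Rightarrow> 'a set set \<Rightarrow> bool" where
  "finite_open_cover X \<U> \<longleftrightarrow> finite \<U> \<and> (\<forall>U\<in>\<U>. openin X U) \<and> \<Union>\<U> = topspace X"

definition strings :: "'a set set \<Rightarrow> nat \<Rightarrow> 'a set list set" where
  "strings \<U> n = {Us. set Us \<subseteq> \<U> \<and> length Us = n}"

definition string_set :: "'a topology \<Rightarrow> (nat \<Rightarrow> 'a \<Rightarrow> 'a) \<Rightarrow> 'a set list \<Rightarrow> 'a set" where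
  "string_set X f Us = {x \<in> topspace X. \<forall>j<length Us. seq_comp f 1 j x \<in> Us ! j}"

text \<open>
  Lengths \<open>n\<close> with \<open>N \<le> n < N/\<theta> + 1\<close>. The case \<open>\<theta> = 0\<close>, where \<open>N/\<theta> = \<infinity>\<close>, is separated
  because \<open>N / 0 = 0\<close> in HOL.
\<close>

definition admissible_lengths :: "nat \<Rightarrow> real \<Rightarrow> nat set" where
  "admissible_lengths N \<theta> = {n. N \<le> n \<and> (\<theta> = 0 \<or> real n < real N / \<theta> + 1)}"

definition admissible_families ::
  "'a topology \<Rightarrow> (nat \<Rightarrow> 'a \<Rightarrow> 'a) \<Rightarrow> 'a set \<Rightarrow> 'a set set \<Rightarrow> nat \<Rightarrow> real \<Rightarrow> 'a set list set set" where
  "admissible_families X f Z \<U> N \<theta> =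
     {\<G>. countable \<G> \<and> \<G> \<subseteq> (\<Union>n\<in>admissible_lengths N \<theta>. strings \<U> n) \<and>
          Z \<subseteq> (\<Union>Us\<in>\<G>. string_set X f Us)}"

definition ent_M ::
  "'a topology \<Rightarrow> (nat \<Rightarrow> 'a \<Rightarrow> 'a) \<Rightarrow> 'a set \<Rightarrow> real \<Rightarrow> 'a set set \<Rightarrow> nat \<Rightarrow> real \<Rightarrow> ennreal" where
  "ent_M X f Z \<alpha> \<U> N \<theta> =
     (INF \<G>\<in>admissible_families X f Z \<U> N \<theta>.
        \<Sum>\<^sub>\<infinity>Us\<in>\<G>. ennreal (exp (- \<alpha> * real (length Us))))"

definition lower_m ::
  "'a topology \<Rightarrow> (nat \<Rightarrow> 'a \<Rightarrow> 'a) \<Rightarrow> 'a set \<Rightarrow> real \<Rightarrow> 'a set set \<Rightarrow> real \<Rightarrow> ennreal" where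
  "lower_m X f Z \<alpha> \<U> \<theta> = liminf (\<lambda>N. ent_M X f Z \<alpha> \<U> N \<theta>)"

definition upper_m ::
  "'a topology \<Rightarrow> (nat \<Rightarrow> 'a \<Rightarrow> 'a) \<Rightarrow> 'a set \<Rightarrow> real \<Rightarrow> 'a set set \<Rightarrow> real \<Rightarrow> ennreal" where
  "upper_m X f Z \<alpha> \<U> \<theta> = limsup (\<lambda>N. ent_M X f Z \<alpha> \<U> N \<theta>)"

definition lower_htop_cover ::
  "'a topology \<Rightarrow> (nat \<Rightarrow> 'a \<Rightarrow> 'a) \<Rightarrow> 'a set \<Rightarrow> 'a set set \<Rightarrow> real \<Rightarrow> ennreal" where
  "lower_htop_cover X f Z \<U> \<theta> = Inf {ennreal \<alpha> | \<alpha>. 0 \<le> \<alpha> \<and> lower_m X f Z \<alpha> \<U> \<theta> = 0}"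

definition upper_htop_cover ::
  "'a topology \<Rightarrow> (nat \<Rightarrow> 'a \<Rightarrow> 'a) \<Rightarrow> 'a set \<Rightarrow> 'a set set \<Rightarrow> real \<Rightarrow> ennreal" where
  "upper_htop_cover X f Z \<U> \<theta> = Inf {ennreal \<alpha> | \<alpha>. 0 \<le> \<alpha> \<and> upper_m X f Z \<alpha> \<U> \<theta> = 0}"

definition lower_htop ::
  "'a topology \<Rightarrow> (nat \<Rightarrow> 'a \<Rightarrow> 'a) \<Rightarrow> 'a set \<Rightarrow> real \<Rightarrow> ennreal" where
  "lower_htop X f Z \<theta> = (SUP \<U>\<in>{\<U>. finite_open_cover X \<U>}. lower_htop_cover X f Z \<U> \<theta>)"

definition upper_htop ::
  "'a topology \<Rightarrow> (nat \<Rightarrow> 'a \<Rightarrow> 'a) \<Rightarrow> 'a set \<Rightarrow> real \<Rightarrow> ennreal" where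
  "upper_htop X f Z \<theta> = (SUP \<U>\<in>{\<U>. finite_open_cover X \<U>}. upper_htop_cover X f Z \<U> \<theta>)"

end

theory Submission
  imports Defs
begin

text \<open>
  A string \<open>U\<close> of length \<open>n\<close> for \<open>f\<close> thins out to \<open>(U\<^sub>0, U\<^sub>m, U\<^bsub>2m\<^esub>, \<dots>)\<close>, a string of length
  \<open>\<lceil>n/m\<rceil>\<close> for the power sequence. Conversely, by periodicity, a string of length \<open>k\<close> for the
  power sequence over the cover by the sets \<open>X(U)\<close>, \<open>U\<close> of length \<open>m\<close>, unfolds to a string of
  length \<open>mk\<close> for \<open>f\<close>, which may have to be truncated by a bounded amount to become admissible. So
  the sums for \<open>f\<close> at \<open>(\<alpha>, N)\<close> and for the power sequence at \<open>(m\<alpha>, \<lceil>N/m\<rceil>)\<close> bound each other up to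
  a constant independent of \<open>N\<close>, and \<open>N \<mapsto> \<lceil>N/m\<rceil>\<close> changes neither lower nor upper limits.
\<close>

section \<open>Sums, lower and upper limits, and infima in the extended half-line\<close>

lemma infsum_cmult_ennreal:
  fixes c :: ennreal
  shows "(\<Sum>\<^sub>\<infinity>x\<in>A. c * f x) = c * (\<Sum>\<^sub>\<infinity>x\<in>A. f x)"
  by (simp add: nonneg_infsum_complete SUP_mult_left_ennreal sum_distrib_left)

text \<open>Distinct strings may be transformed into the same string. Choosing one preimage per
  image point leaves a subset \<open>B\<close> of \<open>A\<close> on which \<open>h\<close> is
  injective; the remaining terms only enlarge the right-hand sum.\<close>

lemma infsum_image_le_ennreal:
  fixes w :: "'b \<Rightarrow> ennreal"
  shows "infsum w (h ` A) \<le> (\<Sum>\<^sub>\<infinity>x\<in>A. w (h x))"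
proof -
  obtain B where B: "B \<subseteq> A" and inj: "inj_on h B" and im: "h ` B = h ` A"
    using subset_image_inj[of "h ` A" h A] by auto
  have "infsum w (h ` A) = (\<Sum>\<^sub>\<infinity>x\<in>B. w (h x))"
    using infsum_reindex[OF inj, of w] im by (simp add: o_def)
  also have "\<dots> \<le> (\<Sum>\<^sub>\<infinity>x\<in>A. w (h x))"
    using B by (intro infsum_mono_neutral nonneg_summable_on_complete) auto
  finally show ?thesis .
qed

lemma liminf_cmult_ennreal:
  fixes f :: "nat \<Rightarrow> ennreal"
  shows "liminf (\<lambda>n. ennreal c * f n) = ennreal c * liminf f"
  by (rule Liminf_compose_continuous_mono)
    (auto intro: ennreal_continuous_on_cmult continuous_on_id simp: mono_def mult_left_mono)

lemma limsup_cmult_ennreal: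
  fixes f :: "nat \<Rightarrow> ennreal"
  shows "limsup (\<lambda>n. ennreal c * f n) = ennreal c * limsup f"
  by (rule Limsup_compose_continuous_mono)
    (auto intro: ennreal_continuous_on_cmult continuous_on_id simp: mono_def mult_left_mono)

text \<open>Since \<open>c\<close> tends to infinity, an eventual bound on \<open>b\<close> is one
  on the composite with \<open>c\<close>. Conversely, \<open>b\<close> is the subsequence of that
  composite along the section \<open>r\<close>. Meant for \<open>c\<close> the rounded-up division
  by \<open>m\<close>, which repeats values.\<close>

lemma liminf_limsup_reindex:
  fixes b :: "nat \<Rightarrow> 'b::complete_linorder"
  assumes "filterlim c sequentially sequentially" "strict_mono r" "\<And>k. c (r k) = k"
  shows "liminf (\<lambda>n. b (c n)) = liminf b" "limsup (\<lambda>n. b (c n)) = limsup b"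
proof -
  have "liminf b \<le> liminf (\<lambda>n. b (c n))"
    unfolding le_Liminf_iff
    using eventually_compose_filterlim[OF less_LiminfD assms(1)] by blast
  moreover have "liminf (\<lambda>n. b (c n)) \<le> liminf b"
    using liminf_subseq_mono[OF assms(2), of "\<lambda>n. b (c n)"] assms(3) by (simp add: o_def)
  ultimately show "liminf (\<lambda>n. b (c n)) = liminf b" by simp
  have "limsup (\<lambda>n. b (c n)) \<le> limsup b"
    unfolding Limsup_le_iff
    using eventually_compose_filterlim[OF Limsup_lessD assms(1)] by blast
  moreover have "limsup b \<le> limsup (\<lambda>n. b (c n))"
    using limsup_subseq_mono[OF assms(2), of "\<lambda>n. b (c n)"] assms(3) by (simp add: o_def)
  ultimately show "limsup (\<lambda>n. b (c n)) = limsup b" by simp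
qed

text \<open>Multiplication by \<open>c\<close> is an order automorphism of the extended half-line,
  inverted by division by \<open>c\<close>.\<close>

lemma le_cmult_Inf_ennreal:
  fixes a c :: ennreal
  assumes c: "c \<noteq> 0" "c \<noteq> top" and le: "\<And>x. x \<in> A \<Longrightarrow> a \<le> c * x"
  shows "a \<le> c * Inf A"
proof -
  have cancel: "c * x / c = x" for x
    using mult_divide_eq_ennreal[OF c, of x] by (simp add: mult.commute)
  have "a / c \<le> Inf A"
    using divide_right_mono_ennreal[OF le, of _ c] by (intro Inf_greatest) (simp add: cancel)
  then have "c * (a / c) \<le> c * Inf A"
    by (rule mult_left_mono) simp
  then show ?thesis
    by (simp add: ennreal_times_divide cancel)
qed

lemma Inf_ennreal_scale:
  assumes "0 < m" "\<And>\<alpha>. 0 \<le> \<alpha> \<Longrightarrow> P \<alpha> \<Longrightarrow> Q (real m * \<alpha>)"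
  shows "Inf {ennreal \<beta> | \<beta>. 0 \<le> \<beta> \<and> Q \<beta>} \<le> of_nat m * Inf {ennreal \<alpha> | \<alpha>. 0 \<le> \<alpha> \<and> P \<alpha>}"
proof (rule le_cmult_Inf_ennreal)
  fix x assume "x \<in> {ennreal \<alpha> | \<alpha>. 0 \<le> \<alpha> \<and> P \<alpha>}"
  then obtain \<alpha> where \<alpha>: "x = ennreal \<alpha>" "0 \<le> \<alpha>" "P \<alpha>" by auto
  have "Inf {ennreal \<beta> | \<beta>. 0 \<le> \<beta> \<and> Q \<beta>} \<le> ennreal (real m * \<alpha>)"
    using \<alpha> assms by (intro Inf_lower) auto
  also have "\<dots> = of_nat m * x"
    using \<alpha> by (simp add: ennreal_mult ennreal_of_nat_eq_real_of_nat)
  finally show "Inf {ennreal \<beta> | \<beta>. 0 \<le> \<beta> \<and> Q \<beta>} \<le> of_nat m * x" .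
qed (use assms(1) in auto)

lemma Inf_ennreal_scale_le:
  assumes "0 < m" "\<And>\<alpha>. 0 \<le> \<alpha> \<Longrightarrow> Q (real m * \<alpha>) \<Longrightarrow> P \<alpha>"
  shows "of_nat m * Inf {ennreal \<alpha> | \<alpha>. 0 \<le> \<alpha> \<and> P \<alpha>} \<le> Inf {ennreal \<beta> | \<beta>. 0 \<le> \<beta> \<and> Q \<beta>}"
proof (rule Inf_greatest)
  fix x assume "x \<in> {ennreal \<beta> | \<beta>. 0 \<le> \<beta> \<and> Q \<beta>}"
  then obtain \<beta> where \<beta>: "x = ennreal \<beta>" "0 \<le> \<beta>" "Q \<beta>" by auto
  \<comment> \<open>The second assumption applies because \<beta> is \<open>m\<close> times \<beta>
    / \<open>m\<close>.\<close>
  have "P (\<beta> / real m)"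
    using assms \<beta> by auto
  then have "Inf {ennreal \<alpha> | \<alpha>. 0 \<le> \<alpha> \<and> P \<alpha>} \<le> ennreal (\<beta> / real m)"
    using \<beta> by (intro Inf_lower) auto
  then have "of_nat m * Inf {ennreal \<alpha> | \<alpha>. 0 \<le> \<alpha> \<and> P \<alpha>} \<le> of_nat m * ennreal (\<beta> / real m)"
    by (rule mult_left_mono) simp
  also have "\<dots> = x"
    using \<beta> assms(1) by (simp add: ennreal_of_nat_eq_real_of_nat flip: ennreal_mult)
  finally show "of_nat m * Inf {ennreal \<alpha> | \<alpha>. 0 \<le> \<alpha> \<and> P \<alpha>} \<le> x" .
qed

section \<open>Division rounded up, and its effect on admissible lengths\<close>

text \<open>For \<open>m > 0\<close> this is the ceiling of \<open>n / m\<close>, the length of a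
  string of length \<open>n\<close> after thinning.\<close>

definition cdiv :: "nat \<Rightarrow> nat \<Rightarrow> nat" where
  "cdiv n m = (n + m - 1) div m"

text \<open>The indices \<open>j\<close> of the thinned string are exactly those for which position
  \<open>j * m\<close> exists in the original one; the other facts on \<open>cdiv\<close> mostly
  come from this.\<close>

lemma less_cdiv_iff:
  assumes "0 < m"
  shows "j < cdiv n m \<longleftrightarrow> j * m < n"
proof -
  have "j < cdiv n m \<longleftrightarrow> Suc j * m \<le> n + m - 1"
    using assms by (simp add: cdiv_def Suc_le_eq[symmetric] less_eq_div_iff_mult_less_eq del: mult_Suc)
  also have "\<dots> \<longleftrightarrow> j * m < n"
    using assms by auto
  finally show ?thesis .
qed

lemma cdiv_le_iff: "0 < m \<Longrightarrow> cdiv n m \<le> j \<longleftrightarrow> n \<le> j * m"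
  using less_cdiv_iff[of m j n] by linarith

lemma cdiv_mult [simp]: "0 < m \<Longrightarrow> cdiv (m * k) m = k"
  using less_cdiv_iff[of m "cdiv (m * k) m" "m * k"] cdiv_le_iff[of m "m * k" k]
  by (simp add: mult.commute)

lemma cdiv_mono: "0 < m \<Longrightarrow> n \<le> n' \<Longrightarrow> cdiv n m \<le> cdiv n' m"
  by (simp add: cdiv_def div_le_mono)

lemma le_cdiv_mult: "0 < m \<Longrightarrow> n \<le> cdiv n m * m"
  using cdiv_le_iff by blast

lemma cdiv_mult_less:
  assumes "0 < m"
  shows "cdiv n m * m < n + m"
proof -
  have "cdiv n m * m \<le> n + m - 1" by (simp add: cdiv_def)
  then show ?thesis using assms by simp
qed

lemma filterlim_cdiv:
  assumes "0 < m"
  shows "filterlim (\<lambda>n. cdiv n m) sequentially sequentially"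
proof (rule filterlim_at_top[THEN iffD2], rule allI)
  fix k
  have "k \<le> cdiv n m" if "m * k \<le> n" for n
    using cdiv_mono[OF assms that] assms by simp
  then show "eventually (\<lambda>n. k \<le> cdiv n m) sequentially"
    using eventually_sequentially by blast
qed

text \<open>Thinning keeps lengths admissible with no loss: the \<open>+ 1\<close> in the upper
  bound for lengths absorbs the rounding.\<close>

lemma admissible_lengths_cdiv:
  assumes m: "0 < m" and \<theta>: "0 \<le> \<theta>" and n: "n \<in> admissible_lengths N \<theta>"
  shows "cdiv n m \<in> admissible_lengths (cdiv N m) \<theta>"
proof -
  have "real (cdiv n m) < real (cdiv N m) / \<theta> + 1" if "\<theta> > 0"
  proof (cases "cdiv n m")
    case 0
    then show ?thesis using that by (simp add: add_nonneg_pos)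
  next
    case (Suc j)
    then have "j * m < n"
      using less_cdiv_iff[OF m, of j n] by simp
    \<comment> \<open>A strict inequality between integers gains the unit that cancels the
      \<open>+ 1\<close> of the length bound.\<close>
    then have "real j * real m + 1 \<le> real n"
      by (metis Suc_leI Suc_eq_plus1 of_nat_1 of_nat_add of_nat_le_iff of_nat_mult)
    also have "real n < real N / \<theta> + 1"
      using n that by (auto simp: admissible_lengths_def)
    also have "real N / \<theta> \<le> real (cdiv N m) * real m / \<theta>"
      using le_cdiv_mult[OF m, of N] that
      by (intro divide_right_mono) (auto simp flip: of_nat_mult)
    finally have "real j * real m < (real (cdiv N m) / \<theta>) * real m"
      by simp
    then have "real j < real (cdiv N m) / \<theta>"
      using m by (subst (asm) mult_less_cancel_right_pos) simp_all
    then show ?thesis using Suc by simp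
  qed
  then show ?thesis
    using n m \<theta> by (cases "\<theta> = 0") (simp_all add: admissible_lengths_def cdiv_mono)
qed

text \<open>For \<open>\<theta> = 0\<close> no truncation is needed, and \<open>m / \<theta>\<close> is \<open>0\<close>.\<close>

lemma admissible_lengths_unfold:
  assumes m: "0 < m" and \<theta>: "0 \<le> \<theta>" and \<theta>1: "\<theta> \<le> 1"
    and k: "k \<in> admissible_lengths (cdiv N m) \<theta>"
  obtains n where "n \<in> admissible_lengths N \<theta>" "n \<le> m * k"
    "real m * real k \<le> real n + (real m / \<theta> + real m)"
proof (cases "\<theta> = 0")
  case True
  have "N \<le> m * k"
    using k cdiv_le_iff[OF m] by (auto simp: admissible_lengths_def mult.commute)
  then show ?thesis
    using True by (intro that[of "m * k"]) (auto simp: admissible_lengths_def)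
next
  case False
  then have \<theta>0: "\<theta> > 0" using \<theta> by simp
  have Nk: "N \<le> m * k"
    using k cdiv_le_iff[OF m] by (auto simp: admissible_lengths_def mult.commute)
  \<comment> \<open>The excess of \<open>m * k\<close> over \<open>N / \<theta>\<close> has two
    sources: \<open>m / \<theta>\<close> from rounding \<open>N\<close> up to a multiple of
    \<open>m\<close>, and \<open>m\<close> from the \<open>+ 1\<close> scaled by \<open>m\<close>.
    Neither depends on \<open>N\<close>.\<close>
  have "real m * real k \<le> real m * (real (cdiv N m) / \<theta> + 1)"
    using k False m by (intro mult_left_mono) (auto simp: admissible_lengths_def)
  also have "\<dots> = real (cdiv N m * m) / \<theta> + real m"
    by (simp add: algebra_simps)
  also have "real (cdiv N m * m) / \<theta> \<le> real (N + m) / \<theta>"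
    using cdiv_mult_less[OF m, of N] \<theta>0 by (intro divide_right_mono) linarith+
  finally have mk: "real m * real k \<le> real N / \<theta> + (real m / \<theta> + real m)"
    by (simp add: add_divide_distrib)
  show ?thesis
  proof (cases "m * k \<in> admissible_lengths N \<theta>")
    case True
    then show ?thesis using \<theta> by (intro that[of "m * k"]) auto
  next
    case not_adm: False
    \<comment> \<open>The truncation length: a ceiling stays strictly below
      \<open>N / \<theta> + 1\<close>, so it is admissible from above, and being at least
      \<open>N / \<theta>\<close> it loses only the excess just computed.\<close>
    define t where "t = nat \<lceil>real N / \<theta>\<rceil>"
    have t: "real N / \<theta> \<le> real t" "real t < real N / \<theta> + 1"
      using \<theta>0 unfolding t_def by (simp_all, linarith)
    have large: "real N / \<theta> + 1 \<le> real (m * k)"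
      using not_adm Nk by (auto simp: admissible_lengths_def)
    \<comment> \<open>Here \<theta> \<le> 1 enters: it gives
      \<open>N \<le> N / \<theta> \<le> t\<close>, so \<open>t\<close> is not too short.\<close>
    have "real N * \<theta> \<le> real N"
      using \<theta>1 by (simp add: mult_left_le)
    then have "real N \<le> real t"
      using t(1) \<theta>0 by (meson order_trans pos_le_divide_eq)
    moreover from t(2) large have "real t \<le> real (m * k)"
      by linarith
    ultimately show ?thesis
      using t mk by (intro that[of t]) (simp_all add: admissible_lengths_def del: of_nat_mult)
  qed
qed

section \<open>Iterates of the sequence, its power and periodicity\<close>

lemma seq_comp_add: "seq_comp f i (j + k) = seq_comp f (i + j) k \<circ> seq_comp f i j"
  by (induction k) (auto simp: add.assoc)

lemma seq_comp_seq_power: "seq_comp (seq_power f m) 1 k = seq_comp f 1 (k * m)"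
proof (induction k)
  case (Suc k)
  have "seq_comp f 1 (Suc k * m) = seq_comp f 1 (k * m + m)"
    by (simp add: add.commute)
  then show ?case
    using Suc by (simp add: seq_power_def seq_comp_add)
qed simp

lemma continuous_map_seq_comp:
  assumes "\<And>i. 1 \<le> i \<Longrightarrow> continuous_map X X (f i)" "1 \<le> i"
  shows "continuous_map X X (seq_comp f i j)"
  using assms by (induction j) (auto intro: continuous_map_compose simp: continuous_map_id)

text \<open>A block of iterates started at a multiple of the period repeats the first block.
  Periodicity is assumed only on the carrier, so the induction uses that orbits stay in it.\<close>

lemma seq_comp_periodic:
  assumes "\<And>i. 1 \<le> i \<Longrightarrow> continuous_map X X (f i)" "periodic_seq_on X f m"
    and "x \<in> topspace X" "j \<le> m"
  shows "seq_comp f (i * m + 1) j x = seq_comp f 1 j x"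
  using assms(4)
proof (induction j)
  case (Suc j)
  have "seq_comp f 1 j x \<in> topspace X"
    using continuous_map_seq_comp[of X f 1 j] assms(1,3) by (auto simp: continuous_map_def)
  moreover have "1 + j \<in> {1..m}" using Suc.prems by auto
  ultimately have "f (i * m + (1 + j)) (seq_comp f 1 j x) = f (1 + j) (seq_comp f 1 j x)"
    using assms(2) unfolding periodic_seq_on_def by blast
  then show ?case
    using Suc by (simp add: add.assoc)
qed simp

section \<open>Comparison of the weighted sums for the sequence and its power\<close>

text \<open>Choosing a transformed string for every admissible string gives a map \<open>h\<close>
  that carries covering families to covering families and raises each weight at most by the factor
  \<open>C\<close>. Thinning and unfolding are the two instances.\<close>

lemma ent_M_transfer:
  assumes C: "0 < C"
    and tr: "\<And>Us n. n \<in> admissible_lengths N \<theta> \<Longrightarrow> Us \<in> strings \<U> n \<Longrightarrow>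
      \<exists>n'\<in>admissible_lengths N' \<theta>. \<exists>Vs\<in>strings \<V> n'.
        string_set X f Us \<subseteq> string_set X g Vs \<and>
        exp (- \<beta> * real (length Vs)) \<le> C * exp (- \<alpha> * real (length Us))"
  shows "ent_M X g Z \<beta> \<V> N' \<theta> \<le> ennreal C * ent_M X f Z \<alpha> \<U> N \<theta>"
proof -
  let ?S = "\<Union>n\<in>admissible_lengths N \<theta>. strings \<U> n"
  let ?w = "\<lambda>\<gamma> Us. ennreal (exp (- \<gamma> * real (length Us)))"
  have "\<forall>Us\<in>?S. \<exists>Vs. Vs \<in> (\<Union>n\<in>admissible_lengths N' \<theta>. strings \<V> n) \<and>
      string_set X f Us \<subseteq> string_set X g Vs \<and>
      exp (- \<beta> * real (length Vs)) \<le> C * exp (- \<alpha> * real (length Us))"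
    using tr by blast
  then obtain h where h: "\<And>Us. Us \<in> ?S \<Longrightarrow>
      h Us \<in> (\<Union>n\<in>admissible_lengths N' \<theta>. strings \<V> n) \<and>
      string_set X f Us \<subseteq> string_set X g (h Us) \<and>
      exp (- \<beta> * real (length (h Us))) \<le> C * exp (- \<alpha> * real (length Us))"
    by metis
  have C': "ennreal C \<noteq> 0" "ennreal C \<noteq> top" using C by auto
  show ?thesis
    unfolding ent_M_def[of X f]
  proof (rule le_cmult_Inf_ennreal[OF C'], elim imageE, hypsubst)
    fix \<G> assume "\<G> \<in> admissible_families X f Z \<U> N \<theta>"
    then have \<G>: "countable \<G>" "\<G> \<subseteq> ?S" "Z \<subseteq> (\<Union>Us\<in>\<G>. string_set X f Us)"
      by (auto simp: admissible_families_def)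
    have "h ` \<G> \<subseteq> (\<Union>n\<in>admissible_lengths N' \<theta>. strings \<V> n)"
      using \<G>(2) h by blast
    moreover have "Z \<subseteq> (\<Union>Vs\<in>h ` \<G>. string_set X g Vs)"
    proof
      fix x assume "x \<in> Z"
      then obtain Us where "Us \<in> \<G>" "x \<in> string_set X f Us"
        using \<G>(3) by blast
      then show "x \<in> (\<Union>Vs\<in>h ` \<G>. string_set X g Vs)"
        using h[of Us] \<G>(2) by auto
    qed
    ultimately have "h ` \<G> \<in> admissible_families X g Z \<V> N' \<theta>"
      using \<G>(1) by (simp add: admissible_families_def)
    then have "ent_M X g Z \<beta> \<V> N' \<theta> \<le> infsum (?w \<beta>) (h ` \<G>)"
      unfolding ent_M_def by (rule INF_lower)
    also have "\<dots> \<le> (\<Sum>\<^sub>\<infinity>Us\<in>\<G>. ?w \<beta> (h Us))"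
      by (rule infsum_image_le_ennreal)
    also have "\<dots> \<le> (\<Sum>\<^sub>\<infinity>Us\<in>\<G>. ennreal C * ?w \<alpha> Us)"
    proof (rule infsum_mono)
      fix Us assume "Us \<in> \<G>"
      then have "exp (- \<beta> * real (length (h Us))) \<le> C * exp (- \<alpha> * real (length Us))"
        using h \<G>(2) by blast
      then show "?w \<beta> (h Us) \<le> ennreal C * ?w \<alpha> Us"
        using C by (simp add: ennreal_leI flip: ennreal_mult)
    qed (simp_all add: nonneg_summable_on_complete)
    also have "\<dots> = ennreal C * (\<Sum>\<^sub>\<infinity>Us\<in>\<G>. ?w \<alpha> Us)"
      by (rule infsum_cmult_ennreal)
    finally show "ent_M X g Z \<beta> \<V> N' \<theta> \<le> ennreal C * (\<Sum>\<^sub>\<infinity>Us\<in>\<G>. ?w \<alpha> Us)" .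
  qed
qed

lemma ent_M_seq_power_le:
  assumes m: "0 < m" and \<theta>: "0 \<le> \<theta>" and \<alpha>: "0 \<le> \<alpha>"
  shows "ent_M X (seq_power f m) Z (real m * \<alpha>) \<U> (cdiv N m) \<theta> \<le> ent_M X f Z \<alpha> \<U> N \<theta>"
proof -
  have "ent_M X (seq_power f m) Z (real m * \<alpha>) \<U> (cdiv N m) \<theta> \<le> ennreal 1 * ent_M X f Z \<alpha> \<U> N \<theta>"
  proof (rule ent_M_transfer)
    fix Us n assume n: "n \<in> admissible_lengths N \<theta>" and Us: "Us \<in> strings \<U> n"
    define Vs where "Vs = map (\<lambda>j. Us ! (j * m)) [0..<cdiv n m]"
    have len: "length Us = n" "length Vs = cdiv n m"
      using Us by (auto simp: strings_def Vs_def)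
    have "Vs \<in> strings \<U> (cdiv n m)"
      using Us m by (fastforce simp: strings_def Vs_def less_cdiv_iff)
    \<comment> \<open>The conditions imposed by \<open>Vs\<close> are those of \<open>Us\<close> at
      times divisible by \<open>m\<close>.\<close>
    moreover have "string_set X f Us \<subseteq> string_set X (seq_power f m) Vs"
      using m by (auto simp: string_set_def len less_cdiv_iff seq_comp_seq_power[simplified] Vs_def)
    moreover have "exp (- (real m * \<alpha>) * real (length Vs)) \<le> 1 * exp (- \<alpha> * real (length Us))"
    proof -
      have "real n \<le> real (cdiv n m) * real m"
        using le_cdiv_mult[OF m, of n] by (metis of_nat_le_iff of_nat_mult)
      then have "\<alpha> * real n \<le> \<alpha> * (real (cdiv n m) * real m)"
        using \<alpha> by (rule mult_left_mono)
      then show ?thesis by (simp add: len mult_ac)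
    qed
    ultimately show "\<exists>n'\<in>admissible_lengths (cdiv N m) \<theta>. \<exists>Vs\<in>strings \<U> n'.
        string_set X f Us \<subseteq> string_set X (seq_power f m) Vs \<and>
        exp (- (real m * \<alpha>) * real (length Vs)) \<le> 1 * exp (- \<alpha> * real (length Us))"
      using admissible_lengths_cdiv[OF m \<theta> n] by blast
  qed simp
  then show ?thesis by simp
qed

text \<open>This cover records the itinerary over a whole block of \<open>m\<close> steps, which the
  power sequence skips.\<close>

lemma finite_open_cover_string_sets:
  assumes "\<And>i. 1 \<le> i \<Longrightarrow> continuous_map X X (f i)" and \<U>: "finite_open_cover X \<U>"
  shows "finite_open_cover X (string_set X f ` strings \<U> m)"
  unfolding finite_open_cover_def
proof (intro conjI ballI)
  show "finite (string_set X f ` strings \<U> m)"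
    using \<U> by (simp add: finite_open_cover_def strings_def finite_lists_length_eq)
next
  fix V assume "V \<in> string_set X f ` strings \<U> m"
  then obtain Us where Us: "Us \<in> strings \<U> m" "V = string_set X f Us" by blast
  have "V = topspace X \<inter> (\<Inter>j\<in>{..<length Us}. {x \<in> topspace X. seq_comp f 1 j x \<in> Us ! j})"
    using Us by (auto simp: string_set_def)
  moreover have "openin X {x \<in> topspace X. seq_comp f 1 j x \<in> Us ! j}" if "j < length Us" for j
    using that Us \<U> nth_mem[OF that]
    by (intro openin_continuous_map_preimage[OF continuous_map_seq_comp[OF assms(1)]])
      (use that in \<open>auto simp: strings_def finite_open_cover_def subset_iff\<close>)
  \<comment> \<open>For the empty string the intersection over no indices is \<open>UNIV\<close>,
    and \<open>V\<close> is the whole carrier; hence the separate case.\<close>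
  ultimately show "openin X V"
    by (cases "Us = []") (auto intro!: openin_Int openin_INT)
next
  have "\<exists>Us\<in>strings \<U> m. x \<in> string_set X f Us" if x: "x \<in> topspace X" for x
  proof -
    have "\<exists>U\<in>\<U>. seq_comp f 1 j x \<in> U" for j
      using continuous_map_seq_comp[of X f 1 j] assms(1) x \<U>
      by (fastforce simp: finite_open_cover_def continuous_map_def)
    then obtain u where "\<And>j. u j \<in> \<U> \<and> seq_comp f 1 j x \<in> u j" by metis
    then show ?thesis
      using x by (intro bexI[of _ "map u [0..<m]"]) (auto simp: string_set_def strings_def)
  qed
  then show "\<Union>(string_set X f ` strings \<U> m) = topspace X"
    by (auto simp: string_set_def)
qed

text \<open>Each entry of a string over the refined cover is replaced by a string of length
  \<open>m\<close> defining it. The constant pays for the entries lost when the result is truncated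
  to an admissible length.\<close>

lemma ent_M_le_seq_power:
  assumes f: "\<And>i. 1 \<le> i \<Longrightarrow> continuous_map X X (f i)" and per: "periodic_seq_on X f m"
    and m: "0 < m" and \<theta>: "0 \<le> \<theta>" "\<theta> \<le> 1" and \<alpha>: "0 \<le> \<alpha>"
  shows "ent_M X f Z \<alpha> \<U> N \<theta> \<le> ennreal (exp (\<alpha> * (real m / \<theta> + real m))) *
    ent_M X (seq_power f m) Z (real m * \<alpha>) (string_set X f ` strings \<U> m) (cdiv N m) \<theta>"
proof (rule ent_M_transfer)
  let ?\<V> = "string_set X f ` strings \<U> m" and ?C = "real m / \<theta> + real m"
  fix Vs k assume k: "k \<in> admissible_lengths (cdiv N m) \<theta>" and Vs: "Vs \<in> strings ?\<V> k"
  obtain n where n: "n \<in> admissible_lengths N \<theta>" "n \<le> m * k" "real m * real k \<le> real n + ?C"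
    using admissible_lengths_unfold[OF m \<theta> k] .
  \<comment> \<open>Different strings can define the same set, so one representative per set is
    fixed.\<close>
  define s where "s = inv_into (strings \<U> m) (string_set X f)"
  have s: "s V \<in> strings \<U> m \<and> string_set X f (s V) = V" if "V \<in> ?\<V>" for V
    unfolding s_def using inv_into_into[OF that] f_inv_into_f[OF that] ..
  \<comment> \<open>Time \<open>l\<close> lies in block \<open>l div m\<close> at offset
    \<open>l mod m\<close>; stopping at \<open>n\<close> performs the truncation.\<close>
  define Us where "Us = map (\<lambda>l. s (Vs ! (l div m)) ! (l mod m)) [0..<n]"
  have len: "length Vs = k" "length Us = n"
    using Vs by (auto simp: strings_def Us_def)
  have block: "l div m < k \<and> s (Vs ! (l div m)) \<in> strings \<U> m
      \<and> string_set X f (s (Vs ! (l div m))) = Vs ! (l div m)" if "l < n" for l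
  proof -
    have "l div m < k"
      using that n(2) m by (simp add: div_less_iff_less_mult mult.commute)
    moreover from this have "Vs ! (l div m) \<in> ?\<V>"
      using Vs len nth_mem by (fastforce simp: strings_def)
    ultimately show ?thesis using s by blast
  qed
  have "Us \<in> strings \<U> n"
  proof -
    have "s (Vs ! (l div m)) ! (l mod m) \<in> \<U>" if "l < n" for l
      using block[OF that] m nth_mem[of "l mod m" "s (Vs ! (l div m))"]
      by (auto simp: strings_def)
    then show ?thesis by (auto simp: strings_def Us_def)
  qed
  moreover have "string_set X (seq_power f m) Vs \<subseteq> string_set X f Us"
  proof
    fix x assume x: "x \<in> string_set X (seq_power f m) Vs"
    then have xX: "x \<in> topspace X" by (simp add: string_set_def)
    have "seq_comp f 1 l x \<in> Us ! l" if l: "l < n" for l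
    proof -
      let ?i = "l div m" and ?j = "l mod m"
      let ?y = "seq_comp f 1 (?i * m) x"
      have j: "?j < m" using m by simp
      have "seq_comp (seq_power f m) 1 ?i x \<in> Vs ! ?i"
        using x block[OF l] len by (simp add: string_set_def)
      then have y: "?y \<in> string_set X f (s (Vs ! ?i))"
        using block[OF l] by (simp only: seq_comp_seq_power)
      \<comment> \<open>The orbit is cut at the last multiple of \<open>m\<close>: up to there it
        follows the power sequence, and afterwards periodicity lets it restart with the first
        map.\<close>
      have "seq_comp f 1 l x = seq_comp f 1 (?i * m + ?j) x"
        by simp
      also have "\<dots> = seq_comp f (?i * m + 1) ?j ?y"
        unfolding seq_comp_add by (simp add: add.commute)
      also have "\<dots> = seq_comp f 1 ?j ?y"
        using y j by (intro seq_comp_periodic[OF f per]) (auto simp: string_set_def)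
      also have "\<dots> \<in> s (Vs ! ?i) ! ?j"
        using y j block[OF l] by (auto simp: string_set_def strings_def)
      finally show ?thesis using l by (simp add: Us_def)
    qed
    then show "x \<in> string_set X f Us"
      using xX len by (simp add: string_set_def)
  qed
  moreover have "exp (- \<alpha> * real (length Us)) \<le> exp (\<alpha> * ?C) * exp (- (real m * \<alpha>) * real (length Vs))"
  proof -
    have "\<alpha> * (real m * real k) \<le> \<alpha> * (real n + ?C)"
      using n(3) \<alpha> by (rule mult_left_mono)
    then have "- \<alpha> * real n \<le> \<alpha> * ?C + - (real m * \<alpha>) * real k"
      by (simp add: algebra_simps)
    then show ?thesis
      unfolding len exp_add[symmetric] by simp
  qed
  ultimately show "\<exists>n\<in>admissible_lengths N \<theta>. \<exists>Us\<in>strings \<U> n.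
      string_set X (seq_power f m) Vs \<subseteq> string_set X f Us \<and>
      exp (- \<alpha> * real (length Us)) \<le> exp (\<alpha> * ?C) * exp (- (real m * \<alpha>) * real (length Vs))"
    using n(1) by blast
qed simp

section \<open>Passage to the limits and to the entropies\<close>

lemma m_seq_power_le:
  assumes m: "0 < m" and \<theta>: "0 \<le> \<theta>" and \<alpha>: "0 \<le> \<alpha>"
  shows "lower_m X (seq_power f m) Z (real m * \<alpha>) \<U> \<theta> \<le> lower_m X f Z \<alpha> \<U> \<theta>"
    and "upper_m X (seq_power f m) Z (real m * \<alpha>) \<U> \<theta> \<le> upper_m X f Z \<alpha> \<U> \<theta>"
proof -
  let ?b = "\<lambda>K. ent_M X (seq_power f m) Z (real m * \<alpha>) \<U> K \<theta>"
  have r: "strict_mono (\<lambda>k. m * k)" "\<And>k. cdiv (m * k) m = k"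
    using m by (auto simp: strict_mono_def)
  \<comment> \<open>The limits along \<open>K\<close> become limits along \<open>N\<close> with
    \<open>K = cdiv N m\<close>, which allows termwise comparison.\<close>
  note reindex = liminf_limsup_reindex[OF filterlim_cdiv[OF m] r, of ?b, symmetric]
  have le: "?b (cdiv N m) \<le> ent_M X f Z \<alpha> \<U> N \<theta>" for N
    using ent_M_seq_power_le[OF m \<theta> \<alpha>] .
  show "lower_m X (seq_power f m) Z (real m * \<alpha>) \<U> \<theta> \<le> lower_m X f Z \<alpha> \<U> \<theta>"
    unfolding lower_m_def reindex(1) by (intro Liminf_mono always_eventually allI le)
  show "upper_m X (seq_power f m) Z (real m * \<alpha>) \<U> \<theta> \<le> upper_m X f Z \<alpha> \<U> \<theta>"
    unfolding upper_m_def reindex(2) by (intro Limsup_mono always_eventually allI le)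
qed

text \<open>Because \<open>C\<close> is finite and independent of \<open>N\<close>, it passes
  through the limits, and vanishing on the right forces vanishing on the left.\<close>

lemma m_le_seq_power:
  fixes \<U> :: "'a set set"
  assumes f: "\<And>i. 1 \<le> i \<Longrightarrow> continuous_map X X (f i)" and per: "periodic_seq_on X f m"
    and m: "0 < m" and \<theta>: "0 \<le> \<theta>" "\<theta> \<le> 1" and \<alpha>: "0 \<le> \<alpha>"
  defines "\<V> \<equiv> string_set X f ` strings \<U> m"
    and "C \<equiv> exp (\<alpha> * (real m / \<theta> + real m))"
  shows "lower_m X f Z \<alpha> \<U> \<theta> \<le> ennreal C * lower_m X (seq_power f m) Z (real m * \<alpha>) \<V> \<theta>"
    and "upper_m X f Z \<alpha> \<U> \<theta> \<le> ennreal C * upper_m X (seq_power f m) Z (real m * \<alpha>) \<V> \<theta>"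
proof -
  let ?b = "\<lambda>K. ent_M X (seq_power f m) Z (real m * \<alpha>) \<V> K \<theta>"
  have r: "strict_mono (\<lambda>k. m * k)" "\<And>k. cdiv (m * k) m = k"
    using m by (auto simp: strict_mono_def)
  note reindex = liminf_limsup_reindex[OF filterlim_cdiv[OF m] r, of ?b, symmetric]
  have le: "ent_M X f Z \<alpha> \<U> N \<theta> \<le> ennreal C * ?b (cdiv N m)" for N
    unfolding \<V>_def C_def by (rule ent_M_le_seq_power[OF f per m \<theta> \<alpha>])
  show "lower_m X f Z \<alpha> \<U> \<theta> \<le> ennreal C * lower_m X (seq_power f m) Z (real m * \<alpha>) \<V> \<theta>"
    unfolding lower_m_def reindex(1) liminf_cmult_ennreal[symmetric]
    by (intro Liminf_mono always_eventually allI le)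
  show "upper_m X f Z \<alpha> \<U> \<theta> \<le> ennreal C * upper_m X (seq_power f m) Z (real m * \<alpha>) \<V> \<theta>"
    unfolding upper_m_def reindex(2) limsup_cmult_ennreal[symmetric]
    by (intro Limsup_mono always_eventually allI le)
qed

theorem proposition3p3:
  fixes X :: "'a topology" and f :: "nat \<Rightarrow> 'a \<Rightarrow> 'a" and m :: nat
    and Z :: "'a set" and \<theta> :: real
  assumes "compact_space X"
    and "\<And>i. 1 \<le> i \<Longrightarrow> continuous_map X X (f i)"
    and "1 \<le> m"
    and "periodic_seq_on X f m"
    and "Z \<subseteq> topspace X"
    and "0 \<le> \<theta>" and "\<theta> \<le> 1"
  shows "lower_htop X (seq_power f m) Z \<theta> = of_nat m * lower_htop X f Z \<theta> \<and>
         upper_htop X (seq_power f m) Z \<theta> = of_nat m * upper_htop X f Z \<theta>"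
proof -
  let ?g = "seq_power f m" and ?covers = "{\<U>. finite_open_cover X \<U>}"
  let ?V = "\<lambda>\<U>. string_set X f ` strings \<U> m"
  have m: "0 < m" using assms(3) by simp
  note le = m_seq_power_le[OF m assms(6)]
    and ge = m_le_seq_power[OF assms(2,4) m assms(6,7)]
  have V: "?V \<U> \<in> ?covers" if "\<U> \<in> ?covers" for \<U>
    using that finite_open_cover_string_sets[OF assms(2)] by simp
  \<comment> \<open>Vanishing for \<open>f\<close> at \<alpha> gives vanishing for the power at
    \<open>m * \<alpha>\<close> over the same cover.\<close>
  have "lower_htop_cover X ?g Z \<U> \<theta> \<le> of_nat m * lower_htop_cover X f Z \<U> \<theta>" for \<U>
    unfolding lower_htop_cover_def using le(1)[of _ X f Z \<U>]
    by (intro Inf_ennreal_scale[OF m]) (metis le_zero_eq)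
  \<comment> \<open>The reverse bound needs the refined cover, which is harmless once the supremum
    over all covers is taken.\<close>
  moreover have "of_nat m * lower_htop_cover X f Z \<U> \<theta> \<le> lower_htop_cover X ?g Z (?V \<U>) \<theta>" for \<U>
    unfolding lower_htop_cover_def using ge(1)[of _ Z \<U>]
    by (intro Inf_ennreal_scale_le[OF m]) (metis le_zero_eq mult_zero_right)
  ultimately have lower: "lower_htop X ?g Z \<theta> = of_nat m * lower_htop X f Z \<theta>"
    unfolding lower_htop_def SUP_mult_left_ennreal
    using V by (intro antisym SUP_mono) blast+
  have "upper_htop_cover X ?g Z \<U> \<theta> \<le> of_nat m * upper_htop_cover X f Z \<U> \<theta>" for \<U>
    unfolding upper_htop_cover_def using le(2)[of _ X f Z \<U>]
    by (intro Inf_ennreal_scale[OF m]) (metis le_zero_eq)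
  moreover have "of_nat m * upper_htop_cover X f Z \<U> \<theta> \<le> upper_htop_cover X ?g Z (?V \<U>) \<theta>" for \<U>
    unfolding upper_htop_cover_def using ge(2)[of _ Z \<U>]
    by (intro Inf_ennreal_scale_le[OF m]) (metis le_zero_eq mult_zero_right)
  ultimately have "upper_htop X ?g Z \<theta> = of_nat m * upper_htop X f Z \<theta>"
    unfolding upper_htop_def SUP_mult_left_ennreal
    using V by (intro antisym SUP_mono) blast+
  with lower show ?thesis by simp
qed

end
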